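(* Let $H$ and $G$ be separable Hilbert spaces, let $Q\in L(H)$ be a nonnegative self-adjoint nuclear operator, and let $A\in L(G,H)$ be an injective bounded linear operator. Set $U:=\operatorname{ran}(A)$ and assume that $U$ and $U^\perp$ are $Q$-invariant. Consider the statistical model on $H$ with probability measures $\mathbb{Q}_\gamma=\mathrm{N}(A\beta,\sigma^2Q)$, $\gamma=(\beta,\sigma^2)\in G\times(0,\infty)$, with observation $Y$, and let $\widehat{\zeta}(Y):=\Pi_UY$. Then there is a unique least square estimator (LSE) for $\beta$; it is given by $\widehat{\beta}(Y)=A^{-1}\widehat{\zeta}(Y)$.
   Context: A subspace $V\subset H$ is $Q$-invariant if $Q(V)\subset V$. In the source it is asserted that, due to the open mapping theorem, the injective operator $A$ is an isomorphism $A\in L(G,U)$ and hence $U$ is a closed subspace of $H$; $A^{-1}:U\to G$ denotes its inverse, and $\Pi_U$ is the orthogonal projection onto $U$. $\mathrm{N}(\xi,\sigma^2Q)$ is the Gaussian measure on $H$ with mean $\xi$ and covariance operator $\sigma^2Q$. $Y$ is the $H$-valued observation (the identity map on $H$). An estimator $\widehat{\beta}(Y)$ with a measurable mapping $\widehat{\beta}:H\to G$ is called a least square estimator (LSE) for $\beta$ if $\|Y-A\widehat{\beta}(Y)\|=\min_{\beta\in G}\|Y-A\beta\|$.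
   Formalization: The range U of A is assumed closed; this does not follow from A being injective and bounded, and if U is not closed no least square estimator exists (points of the closure of U outside U have no minimizer). *)

theory Defs
  imports "HOL-Probability.Probability"
begin

text \<open>A (real) separable Hilbert space is a type of sort
  \<open>{real_inner, complete_space, second_countable_topology}\<close>: for metric spaces second
  countability is separability. No assumption on the dimension is made.\<close>

definition self_adjoint :: "('a::real_inner \<Rightarrow>\<^sub>L 'a) \<Rightarrow> bool" where
  "self_adjoint T \<longleftrightarrow> (\<forall>x y. T x \<bullet> y = x \<bullet> T y)"

definition nonnegative_operator :: "('a::real_inner \<Rightarrow>\<^sub>L 'a) \<Rightarrow> bool" where
  "nonnegative_operator T \<longleftrightarrow> (\<forall>x. 0 \<le> T x \<bullet> x)"

text \<open>\<open>T = \<Sum>n. f\<^sub>n \<otimes> b\<^sub>n\<close> with bounded functionals \<open>f\<^sub>n\<close>, vectors \<open>b\<^sub>n\<close> and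
  \<open>\<Sum>n. \<parallel>f\<^sub>n\<parallel> \<parallel>b\<^sub>n\<parallel> < \<infinity>\<close>.\<close>

definition nuclear_operator ::
    "('a::real_normed_vector \<Rightarrow>\<^sub>L 'b::real_normed_vector) \<Rightarrow> bool" where
  "nuclear_operator T \<longleftrightarrow>
     (\<exists>(f :: nat \<Rightarrow> 'a \<Rightarrow>\<^sub>L real) (b :: nat \<Rightarrow> 'b).
        summable (\<lambda>n. norm (f n) * norm (b n)) \<and> (\<forall>x. (\<lambda>n. blinfun_apply (f n) x *\<^sub>R b n) sums blinfun_apply T x))"

definition invariant_subspace :: "('a::real_normed_vector \<Rightarrow>\<^sub>L 'a) \<Rightarrow> 'a set \<Rightarrow> bool" where
  "invariant_subspace T V \<longleftrightarrow> subspace V \<and> blinfun_apply T ` V \<subseteq> V"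

text \<open>Total via \<open>THE\<close>; meaningful only when \<open>V\<close> admits orthogonal decompositions, e.g.
  when \<open>V\<close> is a closed subspace of a Hilbert space.\<close>

definition orthogonal_projection :: "'a::real_inner set \<Rightarrow> 'a \<Rightarrow> 'a" where
  "orthogonal_projection V x = (THE p. p \<in> V \<and> x - p \<in> V\<^sup>\<bottom>)"

text \<open>Point masses count as (degenerate) normal distributions, since a covariance operator may
  have a nontrivial kernel.\<close>

definition real_gaussian :: "real measure \<Rightarrow> bool" where
  "real_gaussian N \<longleftrightarrow>
     (\<exists>m. N = return borel m) \<or>
     (\<exists>m s. 0 < s \<and> N = density lborel (normal_density m s))"

text \<open>\<open>is_gaussian_measure M m C\<close>: \<open>M\<close> is the Gaussian measure \<open>N(m, C)\<close>, i.e. a Borel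
  probability measure all of whose one-dimensional images \<open>\<langle>\<cdot>, h\<rangle>\<close> are Gaussian, with (weak)
  mean \<open>m\<close> and covariance operator \<open>C\<close>. All integrands below are integrable, because the
  one-dimensional images are Gaussian.\<close>

definition is_gaussian_measure ::
    "'a::{real_inner, complete_space, second_countable_topology} measure \<Rightarrow> 'a \<Rightarrow> ('a \<Rightarrow>\<^sub>L 'a) \<Rightarrow> bool" where
  "is_gaussian_measure M m C \<longleftrightarrow>
     prob_space M \<and> sets M = sets borel \<and>
     (\<forall>h. real_gaussian (distr M borel (\<lambda>x. x \<bullet> h))) \<and>
     (\<forall>h. (LINT x|M. x \<bullet> h) = m \<bullet> h) \<and>
     (\<forall>h k. (LINT x|M. ((x - m) \<bullet> h) * ((x - m) \<bullet> k)) = C h \<bullet> k)"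

text \<open>For a sample space \<open>'w\<close> and an observation \<open>Y\<close>, the estimator is \<open>b \<circ> Y\<close>; the minimum in the
  definition is required at every sample point and is required to be attained.\<close>

definition least_square_estimator ::
    "('g::real_normed_vector \<Rightarrow>\<^sub>L 'h::real_normed_vector) \<Rightarrow> ('w \<Rightarrow> 'h) \<Rightarrow> ('h \<Rightarrow> 'g) \<Rightarrow> bool" where
  "least_square_estimator A Y b \<longleftrightarrow>
     b \<in> borel_measurable borel \<and>
     (\<forall>\<omega>. is_arg_min (\<lambda>\<beta>. norm (Y \<omega> - A \<beta>)) (\<lambda>\<beta>. \<beta> \<in> UNIV) (b (Y \<omega>)))"

end

theory Submission
  imports Defs
begin

text \<open>
  Pythagoras turns the least squares problem into a projection problem: if \<open>\<Pi>\<close> is the orthogonal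
  projection onto the closed subspace \<open>U = ran A\<close>, then
  \<open>\<parallel>y - A \<beta>\<parallel>\<^sup>2 = \<parallel>y - \<Pi> y\<parallel>\<^sup>2 + \<parallel>\<Pi> y - A \<beta>\<parallel>\<^sup>2\<close>, so \<open>\<beta>\<close> is a minimiser exactly when
  \<open>A \<beta> = \<Pi> y\<close> (\<open>least_squares_iff_projection\<close>). Since \<open>A\<close> is injective, this determines \<open>\<beta>\<close> for
  every \<open>y\<close>, and since \<open>Y\<close> is the identity it determines an estimator on the whole of \<open>H\<close>.

  The remaining point is that \<open>A\<^sup>-\<^sup>1 \<circ> \<Pi>\<close> is Borel measurable. The open mapping theorem would make it
  continuous; a weaker fact suffices. A bounded linear map on a Hilbert space sends closed balls to
  closed sets (\<open>closed_bounded_linear_image_Hilbert\<close>, a form of weak compactness of balls), so the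
  preimage of a closed ball under \<open>A\<^sup>-\<^sup>1 \<circ> \<Pi>\<close> is the preimage of a closed set under the continuous
  map \<open>\<Pi>\<close>. In a separable metric space closed balls generate the Borel sets.

  Both this fact and the existence of \<open>\<Pi>\<close> come from a single intersection theorem,
  \<open>closed_convex_nest_Hilbert\<close>: bounded nested nonempty closed convex sets in a Hilbert space have a
  common point. In each case the point that is sought satisfies countably many approximate conditions,
  each of which cuts out a closed convex set.
\<close>

section \<open>Intersections of closed convex sets in a Hilbert space\<close>

lemma exists_dist_less_infdist_add:
  assumes "S \<noteq> {}" "0 < e"
  obtains a where "a \<in> S" "dist x a < infdist x S + e"
proof -
  have "(INF a\<in>S. dist x a) < infdist x S + e"
    using assms by (simp add: infdist_notempty)
  thus ?thesis
    using that assms(1) by (subst (asm) cINF_less_iff) (auto intro: bdd_belowI[of _ 0])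
qed

text \<open>
  Take points \<open>x n \<in> D n\<close> of almost minimal norm. The distances \<open>m n\<close> of the origin from \<open>D n\<close>
  increase to a finite limit \<open>L\<close>. For \<open>n \<le> k\<close> the midpoint of \<open>x n\<close> and \<open>x k\<close> lies in \<open>D n\<close> by
  convexity, hence has norm at least \<open>m n\<close>, while \<open>x n\<close> and \<open>x k\<close> have norm at most about \<open>L\<close>.
  The parallelogram law then makes \<open>x\<close> a Cauchy sequence, and its limit lies in every \<open>D n\<close>.
\<close>

lemma closed_convex_nest_Hilbert:
  fixes D :: "nat \<Rightarrow> 'a::{real_inner, complete_space} set"
  assumes closed: "\<And>n. closed (D n)" and convex: "\<And>n. convex (D n)"
    and nonempty: "\<And>n. D n \<noteq> {}" and bounded: "bounded (D 0)" and decr: "decseq D"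
  obtains x where "\<And>n. x \<in> D n"
proof -
  define m where "m n = infdist 0 (D n)" for n
  have m_le: "m n \<le> norm x" if "x \<in> D n" for n x
    unfolding m_def using infdist_le[OF that, of 0] by simp
  have m_nonneg: "0 \<le> m n" for n
    unfolding m_def by (rule infdist_nonneg)
  have sub: "D k \<subseteq> D n" if "n \<le> k" for n k
    using decr that by (auto simp: decseq_def)
  have "incseq m"
    unfolding incseq_def m_def using sub nonempty by (simp add: infdist_mono)
  obtain B where B: "\<And>x. x \<in> D 0 \<Longrightarrow> norm x \<le> B"
    using bounded by (auto simp: bounded_iff)
  have "m n \<le> B" for n
    using nonempty[of n] m_le sub[of 0 n] B by (meson equals0I order_trans subsetD zero_le)
  with \<open>incseq m\<close> obtain L where L: "m \<longlonglongrightarrow> L" and m_le_L: "\<And>n. m n \<le> L"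
    by (metis incseq_convergent)
  have "\<exists>x\<in>D n. norm x < L + 1 / Suc n" for n
  proof -
    obtain x where "x \<in> D n" "dist 0 x < m n + 1 / Suc n"
      unfolding m_def by (rule exists_dist_less_infdist_add[OF nonempty[of n], of "1 / Suc n" 0]) auto
    thus ?thesis using m_le_L[of n] by (intro bexI[of _ x]) auto
  qed
  then obtain x where xD: "\<And>n. x n \<in> D n" and x_less: "\<And>n. norm (x n) < L + 1 / Suc n"
    by metis
  define c where "c n = 4 * (L + 1 / Suc n)\<^sup>2 - 4 * (m n)\<^sup>2" for n
  have "c \<longlonglongrightarrow> 4 * (L + 0)\<^sup>2 - 4 * L\<^sup>2"
    unfolding c_def by (intro tendsto_intros L LIMSEQ_Suc[OF lim_1_over_n])
  hence c_lim: "c \<longlonglongrightarrow> 0" by simp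
  have close: "(norm (x n - x k))\<^sup>2 \<le> c n" if "n \<le> k" for n k
  proof -
    have x_sq: "(norm (x j))\<^sup>2 \<le> (L + 1 / Suc n)\<^sup>2" if "n \<le> j" for j
    proof (rule power_mono)
      have "1 / real (Suc j) \<le> 1 / Suc n" using that by (simp add: frac_le)
      thus "norm (x j) \<le> L + 1 / Suc n" using x_less[of j] by linarith
    qed simp
    have "(1/2) *\<^sub>R x n + (1/2) *\<^sub>R x k \<in> D n"
      using convexD[OF convex, of "x n" n "x k" "1/2" "1/2"] xD sub[OF that] by auto
    hence "m n \<le> norm ((1/2) *\<^sub>R (x n + x k))"
      by (intro m_le) (simp add: scaleR_add_right)
    hence "(2 * m n)\<^sup>2 \<le> (norm (x n + x k))\<^sup>2"
      using m_nonneg[of n] by (intro power_mono) auto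
    moreover have "(norm (x n - x k))\<^sup>2 = 2 * (norm (x n))\<^sup>2 + 2 * (norm (x k))\<^sup>2 - (norm (x n + x k))\<^sup>2"
      by (simp add: power2_norm_eq_inner algebra_simps inner_commute)
    ultimately show ?thesis
      using x_sq[of n] x_sq[OF that] by (simp add: c_def power_mult_distrib)
  qed
  have "Cauchy x"
    unfolding Cauchy_altdef
  proof (intro allI impI)
    fix e :: real assume "0 < e"
    hence "\<forall>\<^sub>F n in sequentially. c n < e\<^sup>2"
      using c_lim by (intro order_tendstoD) auto
    then obtain N where N: "\<And>n. n \<ge> N \<Longrightarrow> c n < e\<^sup>2"
      by (auto simp: eventually_sequentially)
    have "norm (x n - x k) < e" if "n \<ge> N" "k > n" for n k
    proof (rule power2_less_imp_less)
      show "(norm (x n - x k))\<^sup>2 < e\<^sup>2"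
        using that by (intro order_le_less_trans[OF close N]) simp_all
    qed (use \<open>0 < e\<close> in simp)
    thus "\<exists>M. \<forall>m\<ge>M. \<forall>n>m. dist (x m) (x n) < e"
      unfolding dist_norm by blast
  qed
  then obtain y where y: "x \<longlonglongrightarrow> y"
    by (auto simp: Cauchy_convergent_iff convergent_def)
  have "y \<in> D n" for n
  proof (rule Lim_in_closed_set[OF closed _ _ y])
    show "\<forall>\<^sub>F k in sequentially. x k \<in> D n"
      using xD sub by (intro eventually_sequentiallyI[of n]) blast
  qed simp
  thus ?thesis using that by blast
qed

text \<open>
  This fails for general Banach spaces: a functional that does not attain its norm maps the closed
  unit ball onto an open interval. In a Hilbert space, given \<open>y\<close> in the closure of \<open>f ` C\<close>, the sets
  of points of \<open>C\<close> that \<open>f\<close> maps to within \<open>1 / (n + 1)\<close> of \<open>y\<close> are nested, nonempty, bounded,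
  closed and convex, and a common point of them is a preimage.
\<close>

lemma closed_bounded_linear_image_Hilbert:
  fixes f :: "'a::{real_inner, complete_space} \<Rightarrow> 'b::real_normed_vector"
  assumes f: "bounded_linear f" and C: "closed C" "convex C" "bounded C"
  shows "closed (f ` C)"
proof -
  interpret bounded_linear f by (rule f)
  have "y \<in> f ` C" if y: "y \<in> closure (f ` C)" for y
  proof -
    define D where "D n = C \<inter> f -` cball y (1 / Suc n)" for n :: nat
    have "\<exists>x. \<forall>n. x \<in> D n"
    proof (rule closed_convex_nest_Hilbert[of D])
      show "closed (D n)" for n
        unfolding D_def
        by (intro closed_Int C closed_vimage closed_cball linear_continuous_on f)
      show "convex (D n)" for n
        unfolding D_def by (intro convex_Int C convex_linear_vimage linear convex_cball)
      show "D n \<noteq> {}" for n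
      proof -
        obtain x where "x \<in> C" "dist (f x) y < 1 / Suc n"
          using y unfolding closure_approachable by (metis imageE of_nat_0_less_iff zero_less_Suc zero_less_divide_1_iff)
        thus ?thesis by (auto simp: D_def dist_commute intro!: exI[of _ x] less_imp_le)
      qed
      show "bounded (D 0)" using C by (auto simp: D_def intro: bounded_subset)
      show "decseq D"
        by (auto simp: decseq_def D_def elim!: order_trans intro!: frac_le)
    qed blast
    then obtain x where x: "\<And>n. x \<in> D n" by blast
    have "dist y (f x) \<le> 1 / Suc n" for n using x[of n] by (simp add: D_def)
    hence "dist y (f x) \<le> 0"
      by (intro LIMSEQ_le_const[OF LIMSEQ_Suc[OF lim_1_over_n]]) auto
    thus ?thesis using x[of 0] by (auto simp: D_def)
  qed
  thus ?thesis by (metis closure_subset closed_closure subsetI subset_antisym)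
qed

section \<open>Borel measurability from closed balls\<close>

text \<open>
  By the Lindelof property every open set is a countable union of closed balls: cover it by open balls
  whose closed counterparts stay inside.
\<close>

lemma borel_measurable_if_closed_vimage_cball:
  fixes f :: "'a::topological_space \<Rightarrow> 'b::{metric_space, second_countable_topology}"
  assumes "\<And>c r. closed (f -` cball c r)"
  shows "f \<in> borel_measurable borel"
proof (rule borel_measurableI)
  fix S :: "'b set" assume "open S"
  then obtain r where r: "\<And>c. c \<in> S \<Longrightarrow> 0 < r c \<and> cball c (r c) \<subseteq> S"
    by (metis open_contains_cball)
  obtain F where F: "F \<subseteq> (\<lambda>c. ball c (r c)) ` S" "countable F"
      "\<Union>F = \<Union>((\<lambda>c. ball c (r c)) ` S)"
    by (rule Lindelof[of "(\<lambda>c. ball c (r c)) ` S"]) auto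
  obtain T where T: "T \<subseteq> S" "countable T" "F = (\<lambda>c. ball c (r c)) ` T"
    using countable_subset_image[THEN iffD1] F(1,2) by meson
  have "S = (\<Union>c\<in>T. cball c (r c))"
  proof
    have "S \<subseteq> (\<Union>c\<in>S. ball c (r c))" using r by auto
    also have "\<dots> = (\<Union>c\<in>T. ball c (r c))" using F(3) T(3) by simp
    also have "\<dots> \<subseteq> (\<Union>c\<in>T. cball c (r c))" by (intro UN_mono ball_subset_cball) simp
    finally show "S \<subseteq> (\<Union>c\<in>T. cball c (r c))" .
    show "(\<Union>c\<in>T. cball c (r c)) \<subseteq> S" using r T(1) by blast
  qed
  hence "f -` S = (\<Union>c\<in>T. f -` cball c (r c))" by blast
  moreover have "(\<Union>c\<in>T. f -` cball c (r c)) \<in> sets borel"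
    using T(2) assms by (intro sets.countable_UN'' borel_closed)
  ultimately show "f -` S \<inter> space borel \<in> sets borel" by simp
qed

section \<open>Orthogonal projections\<close>

text \<open>
  A nearest point \<open>p\<close> of \<open>U\<close> is a common point of the sets of \<open>1 / (n + 1)\<close>-nearest points, and the
  variational inequality at \<open>p\<close>, applied to \<open>p + v\<close> and \<open>p - v\<close>, says that \<open>y - p\<close> is orthogonal
  to \<open>v\<close>.
\<close>

lemma closed_subspace_decomposition:
  fixes U :: "'a::{real_inner, complete_space} set"
  assumes "subspace U" "closed U"
  obtains p where "p \<in> U" "y - p \<in> U\<^sup>\<bottom>"
proof -
  have ne: "U \<noteq> {}" using subspace_0[OF \<open>subspace U\<close>] by blast
  define d where "d = infdist y U"
  define D where "D n = U \<inter> cball y (d + 1 / Suc n)" for n :: nat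
  have "\<exists>p. \<forall>n. p \<in> D n"
  proof (rule closed_convex_nest_Hilbert[of D])
    show "closed (D n)" for n
      unfolding D_def by (intro closed_Int closed_cball assms)
    show "convex (D n)" for n
      unfolding D_def by (intro convex_Int convex_cball subspace_imp_convex assms)
    show "D n \<noteq> {}" for n
    proof -
      obtain a where "a \<in> U" "dist y a < d + 1 / Suc n"
        unfolding d_def by (rule exists_dist_less_infdist_add[OF ne, of "1 / Suc n" y]) auto
      thus ?thesis by (auto simp: D_def intro!: exI[of _ a] less_imp_le)
    qed
    show "bounded (D 0)" by (auto simp: D_def)
    show "decseq D"
      by (auto simp: decseq_def D_def elim!: order_trans intro!: frac_le)
  qed blast
  then obtain p where p: "\<And>n. p \<in> D n" by blast
  have "dist y p \<le> d + 1 / Suc n" for n using p[of n] by (simp add: D_def)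
  moreover have "(\<lambda>n. d + 1 / Suc n) \<longlonglongrightarrow> d + 0"
    by (intro tendsto_intros LIMSEQ_Suc[OF lim_1_over_n])
  ultimately have "dist y p \<le> d" by (intro LIMSEQ_le_const[of _ d]) auto
  have pU: "p \<in> U" using p[of 0] by (simp add: D_def)
  have "(y - p) \<bullet> v = 0" if v: "v \<in> U" for v
  proof -
    have le: "(y - p) \<bullet> w \<le> 0" if "w \<in> U" for w
    proof -
      have "\<forall>z\<in>U. dist y p \<le> dist y z"
        using \<open>dist y p \<le> d\<close> infdist_le[of _ U y] by (fastforce simp: d_def)
      moreover have "p + w \<in> U"
        using pU that assms by (simp add: subspace_add)
      ultimately show ?thesis
        using any_closest_point_dot[of U p "p + w" y] pU assms subspace_imp_convex by auto
    qed
    show ?thesis using le[OF v] le[of "- v"] v assms by (simp add: subspace_neg)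
  qed
  hence "y - p \<in> U\<^sup>\<bottom>" by (auto simp: orthogonal_comp_def orthogonal_def inner_commute)
  with pU show ?thesis by (rule that)
qed

lemma orthogonal_projection_eqI:
  assumes "subspace U" "p \<in> U" "x - p \<in> U\<^sup>\<bottom>"
  shows "orthogonal_projection U x = p"
  unfolding orthogonal_projection_def
proof (rule the_equality)
  fix q assume q: "q \<in> U \<and> x - q \<in> U\<^sup>\<bottom>"
  hence "q - p \<in> U" using assms by (simp add: subspace_diff)
  moreover have "(x - p) - (x - q) \<in> U\<^sup>\<bottom>"
    using q assms subspace_diff[OF subspace_orthogonal_comp] by blast
  ultimately have "(q - p) \<bullet> (q - p) = 0"
    by (simp add: orthogonal_comp_def orthogonal_def)
  thus "q = p" by simp
qed (use assms in simp)

lemma orthogonal_projection_decomposition: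
  fixes U :: "'a::{real_inner, complete_space} set"
  assumes "subspace U" "closed U"
  shows "orthogonal_projection U x \<in> U" "x - orthogonal_projection U x \<in> U\<^sup>\<bottom>"
  using closed_subspace_decomposition[OF assms, of x] orthogonal_projection_eqI[OF assms(1)]
  by metis+

lemma norm_diff_orthogonal_projection:
  fixes U :: "'a::{real_inner, complete_space} set"
  assumes "subspace U" "closed U" "u \<in> U"
  shows "(norm (x - u))\<^sup>2 =
    (norm (x - orthogonal_projection U x))\<^sup>2 + (norm (orthogonal_projection U x - u))\<^sup>2"
proof -
  let ?p = "orthogonal_projection U x"
  have "?p - u \<in> U"
    by (intro subspace_diff orthogonal_projection_decomposition(1) assms)
  hence "orthogonal (x - ?p) (?p - u)"
    using orthogonal_projection_decomposition(2)[OF assms(1,2), of x]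
    by (auto simp: orthogonal_comp_def orthogonal_def inner_commute)
  from norm_add_Pythagorean[OF this] show ?thesis by simp
qed

text \<open>Pythagoras applied to \<open>x - y\<close> shows that the projection is even a contraction.\<close>

lemma continuous_on_orthogonal_projection:
  fixes U :: "'a::{real_inner, complete_space} set"
  assumes "subspace U" "closed U"
  shows "continuous_on S (orthogonal_projection U)"
proof (rule lipschitz_on_continuous_on[where L = 1], rule lipschitz_onI)
  fix x y
  let ?p = "orthogonal_projection U"
  have "(x - ?p x) - (y - ?p y) \<in> U\<^sup>\<bottom>"
    by (rule subspace_diff[OF subspace_orthogonal_comp];
        rule orthogonal_projection_decomposition(2)[OF assms])
  moreover have "?p x - ?p y \<in> U"
    using orthogonal_projection_decomposition(1)[OF assms] assms by (intro subspace_diff) auto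
  ultimately have "orthogonal (?p x - ?p y) ((x - ?p x) - (y - ?p y))"
    by (simp add: orthogonal_comp_def)
  from norm_add_Pythagorean[OF this]
  have "(norm (x - y))\<^sup>2 = (norm (?p x - ?p y))\<^sup>2 + (norm ((x - ?p x) - (y - ?p y)))\<^sup>2"
    by (simp add: algebra_simps)
  hence "(norm (?p x - ?p y))\<^sup>2 \<le> (norm (x - y))\<^sup>2" by simp
  thus "dist (?p x) (?p y) \<le> 1 * dist x y"
    unfolding dist_norm mult_1 by (rule power2_le_imp_le) simp
qed simp

section \<open>Least squares\<close>

text \<open>
  In Pythagoras' identity only the term \<open>\<parallel>\<Pi> y - A \<beta>\<parallel>\<close> depends on \<open>\<beta>\<close>, and it vanishes for some \<open>\<beta>\<close>
  because \<open>\<Pi> y\<close> lies in the range of \<open>A\<close>.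
\<close>

lemma least_squares_iff_projection:
  fixes A :: "'g::real_normed_vector \<Rightarrow>\<^sub>L 'h::{real_inner, complete_space}"
  assumes "closed (range A)"
  shows "is_arg_min (\<lambda>\<beta>. norm (y - A \<beta>)) (\<lambda>\<beta>. \<beta> \<in> UNIV) b
    \<longleftrightarrow> A b = orthogonal_projection (range A) y"
proof -
  let ?p = "orthogonal_projection (range A) y"
  have U: "subspace (range A)"
    by (intro linear_subspace_image subspace_UNIV bounded_linear.linear blinfun.bounded_linear_right)
  obtain b0 where b0: "A b0 = ?p"
    using orthogonal_projection_decomposition(1)[OF U assms, of y] by (metis imageE)
  have pyth: "(norm (y - A \<beta>))\<^sup>2 = (norm (y - ?p))\<^sup>2 + (norm (?p - A \<beta>))\<^sup>2" for \<beta>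
    using norm_diff_orthogonal_projection[OF U assms] by blast
  show ?thesis
  proof
    assume "is_arg_min (\<lambda>\<beta>. norm (y - A \<beta>)) (\<lambda>\<beta>. \<beta> \<in> UNIV) b"
    hence "norm (y - A b) \<le> norm (y - A b0)" by (simp add: is_arg_min_linorder)
    hence "(norm (y - A b))\<^sup>2 \<le> (norm (y - A b0))\<^sup>2" by (simp add: power_mono)
    hence "(norm (?p - A b))\<^sup>2 \<le> 0" by (simp add: pyth b0)
    thus "A b = ?p" by simp
  next
    assume "A b = ?p"
    hence "(norm (y - A b))\<^sup>2 \<le> (norm (y - A \<beta>))\<^sup>2" for \<beta>
      unfolding pyth[of \<beta>] by simp
    hence "norm (y - A b) \<le> norm (y - A \<beta>)" for \<beta>
      by (rule power2_le_imp_le) simp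
    thus "is_arg_min (\<lambda>\<beta>. norm (y - A \<beta>)) (\<lambda>\<beta>. \<beta> \<in> UNIV) b"
      by (simp add: is_arg_min_linorder)
  qed
qed

theorem proposition10p2:
  fixes Q :: "'h::{real_inner, complete_space, second_countable_topology} \<Rightarrow>\<^sub>L 'h"
    and A :: "'g::{real_inner, complete_space, second_countable_topology} \<Rightarrow>\<^sub>L 'h"
    and U :: "'h set"
    and P :: "'g \<times> real \<Rightarrow> 'h measure"
    and Y :: "'h \<Rightarrow> 'h"
    and zeta_hat :: "'h \<Rightarrow> 'h"
  assumes "nonnegative_operator Q" and "self_adjoint Q" and "nuclear_operator Q"
    and "inj (blinfun_apply A)"
    and "U = range (blinfun_apply A)"
    and "closed U"
    and "invariant_subspace Q U" and "invariant_subspace Q (U\<^sup>\<bottom>)"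
    and "\<And>\<beta> s. 0 < s \<Longrightarrow> is_gaussian_measure (P (\<beta>, s)) (A \<beta>) (s *\<^sub>R Q)"
    and "Y = id"
    and "\<And>y. zeta_hat y = orthogonal_projection U y"
  shows "(\<exists>!b. least_square_estimator A Y b) \<and>
         least_square_estimator A Y (\<lambda>y. inv_into UNIV (blinfun_apply A) (zeta_hat y))"
proof -
  have subspace: "subspace U"
    using assms(7) by (simp add: invariant_subspace_def)
  define beta_hat where "beta_hat = (\<lambda>y. inv_into UNIV A (zeta_hat y))"
  have zeta_ran: "zeta_hat y \<in> range A" for y
    using orthogonal_projection_decomposition(1)[OF subspace assms(6), of y] assms(5,11) by simp
  have A_eq_iff: "A b = zeta_hat y \<longleftrightarrow> b = beta_hat y" for b y
    unfolding beta_hat_def using zeta_ran[of y] assms(4) by (metis f_inv_into_f inv_into_f_f UNIV_I)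
  have arg_min: "is_arg_min (\<lambda>\<beta>. norm (Y y - A \<beta>)) (\<lambda>\<beta>. \<beta> \<in> UNIV) b \<longleftrightarrow> b = beta_hat y"
    for b y
    using least_squares_iff_projection[of A y b] A_eq_iff assms(5,6,10,11) by simp
  have lse_iff: "least_square_estimator A Y b \<longleftrightarrow>
      b \<in> borel_measurable borel \<and> (\<forall>y. b y = beta_hat y)" for b
    unfolding least_square_estimator_def arg_min using assms(10) by simp
  have "beta_hat \<in> borel_measurable borel"
  proof (rule borel_measurable_if_closed_vimage_cball)
    fix c r
    have "zeta_hat y = A x \<longleftrightarrow> x = beta_hat y" for x y
      using A_eq_iff[of x y] by metis
    hence "beta_hat -` cball c r = zeta_hat -` (A ` cball c r)"
      by (simp add: set_eq_iff image_iff del: mem_cball)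
    moreover have "closed (A ` cball c r)"
      by (intro closed_bounded_linear_image_Hilbert blinfun.bounded_linear_right
          closed_cball convex_cball bounded_cball)
    moreover have "zeta_hat = orthogonal_projection U"
      using assms(11) by blast
    hence "continuous_on UNIV zeta_hat"
      using continuous_on_orthogonal_projection[OF subspace assms(6)] by simp
    ultimately show "closed (beta_hat -` cball c r)"
      by (simp add: closed_vimage)
  qed
  hence "least_square_estimator A Y beta_hat"
    by (simp add: lse_iff)
  moreover have "b = beta_hat" if "least_square_estimator A Y b" for b
    using that by (auto simp: lse_iff)
  ultimately show ?thesis
    unfolding beta_hat_def by blast
qed

end
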